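(* Let $A\in\mathbb{C}_{n,n}$ with $\mathrm{Ind}(A)=k$. If $A$ is $\mathfrak{m}$-core-EP invertible, then $$A^{(\mathrm{E})}=A^{k}A^{D}\big(A^{k}\big)^{(\mathrm{m})},$$ where $A^D$ is the Drazin inverse of $A$ and $(A^k)^{(\mathrm{m})}$ is the $\mathfrak{m}$-core inverse of $A^k$.
   Context: $\mathbb{C}_{n,n}$ is the set of $n\times n$ complex matrices; $A^*$, $\mathrm{rk}(A)$, $\mathcal{R}(A)$ denote conjugate transpose, rank and column space. $\mathrm{Ind}(A)$ is the smallest positive integer $k$ with $\mathrm{rk}(A^{k+1})=\mathrm{rk}(A^k)$. The Minkowski metric matrix is $G=\begin{bmatrix}1&0\\ 0&-I_{n-1}\end{bmatrix}$ and the Minkowski adjoint of $A$ is $A^{\sim}=GA^*G$. For $A$ with $\mathrm{Ind}(A)=k$, the $\mathfrak{m}$-core-EP inverse $A^{(\mathrm{E})}$ of $A$ is the matrix $X\in\mathbb{C}_{n,n}$ (unique if it exists) satisfying $XAX=X$, $XA^{k+1}=A^k$, $(AX)^{\sim}=AX$ and $\mathcal{R}(X)\subseteq\mathcal{R}(A^k)$; $A$ is $\mathfrak{m}$-core-EP invertible if such $X$ exists. For $B\in\mathbb{C}_{n,n}$ with $\mathrm{rk}(B^2)=\mathrm{rk}(B)$, the $\mathfrak{m}$-core inverse $B^{(\mathrm{m})}$ is the matrix $X$ (unique if it exists) satisfying $BXB=B$, $BX^2=X$, $(BX)^{\sim}=BX$; it exists if and only if $\mathrm{rk}(B^{\sim}B)=\mathrm{rk}(B)$.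 The Drazin inverse $A^D$ is the unique $X$ with $A^kXA=A^k$, $XAX=X$, $AX=XA$, where $k=\mathrm{Ind}(A)$. *)

theory Defs
  imports
    Jordan_Normal_Form.DL_Rank
    Jordan_Normal_Form.Schur_Decomposition
begin

text \<open>
  The space of complex \<open>n \<times> n\<close> matrices is rendered as \<open>carrier_mat n n\<close>.
  Since the type \<open>complex mat\<close> contains matrices of all dimensions, every
  ``the matrix \<open>X\<close> such that'' below is restricted to that carrier.
\<close>

abbreviation rk :: "nat \<Rightarrow> complex mat \<Rightarrow> nat" where
  "rk n A \<equiv> vec_space.rank n A"

abbreviation col_sp :: "nat \<Rightarrow> complex mat \<Rightarrow> complex vec set" where
  "col_sp n A \<equiv> vec_space.col_space n A"

text \<open>The index is at least 1 by convention, also for nonsingular matrices.\<close>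

definition Ind :: "nat \<Rightarrow> complex mat \<Rightarrow> nat" where
  "Ind n A = (LEAST k. 0 < k \<and> rk n (A ^\<^sub>m (k + 1)) = rk n (A ^\<^sub>m k))"

text \<open>Only meaningful for \<open>n \<ge> 1\<close> (for \<open>n = 0\<close> the block matrix would be \<open>1 \<times> 1\<close>).\<close>

definition minkowski_metric :: "nat \<Rightarrow> complex mat" where
  "minkowski_metric n =
     four_block_mat (1\<^sub>m 1) (0\<^sub>m 1 (n - 1)) (0\<^sub>m (n - 1) 1) (- 1\<^sub>m (n - 1))"

definition minkowski_adjoint :: "nat \<Rightarrow> complex mat \<Rightarrow> complex mat" where
  "minkowski_adjoint n A = minkowski_metric n * mat_adjoint A * minkowski_metric n"

definition is_m_core_EP_inverse :: "nat \<Rightarrow> complex mat \<Rightarrow> complex mat \<Rightarrow> bool" where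
  "is_m_core_EP_inverse n A X \<longleftrightarrow>
     X \<in> carrier_mat n n \<and>
     X * A * X = X \<and>
     X * A ^\<^sub>m (Ind n A + 1) = A ^\<^sub>m Ind n A \<and>
     minkowski_adjoint n (A * X) = A * X \<and>
     col_sp n X \<subseteq> col_sp n (A ^\<^sub>m Ind n A)"

definition m_core_EP_invertible :: "nat \<Rightarrow> complex mat \<Rightarrow> bool" where
  "m_core_EP_invertible n A \<longleftrightarrow> (\<exists>X. is_m_core_EP_inverse n A X)"

definition m_core_EP_inverse :: "nat \<Rightarrow> complex mat \<Rightarrow> complex mat" where
  "m_core_EP_inverse n A = (THE X. is_m_core_EP_inverse n A X)"

text \<open>The m-core inverse is defined for \<open>B\<close> with \<open>rk (B\<^sup>2) = rk B\<close> only.\<close>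

definition is_m_core_inverse :: "nat \<Rightarrow> complex mat \<Rightarrow> complex mat \<Rightarrow> bool" where
  "is_m_core_inverse n B X \<longleftrightarrow>
     rk n (B ^\<^sub>m 2) = rk n B \<and>
     X \<in> carrier_mat n n \<and>
     B * X * B = B \<and>
     B * X ^\<^sub>m 2 = X \<and>
     minkowski_adjoint n (B * X) = B * X"

definition m_core_invertible :: "nat \<Rightarrow> complex mat \<Rightarrow> bool" where
  "m_core_invertible n B \<longleftrightarrow> (\<exists>X. is_m_core_inverse n B X)"

definition m_core_inverse :: "nat \<Rightarrow> complex mat \<Rightarrow> complex mat" where
  "m_core_inverse n B = (THE X. is_m_core_inverse n B X)"

definition is_drazin_inverse :: "nat \<Rightarrow> complex mat \<Rightarrow> complex mat \<Rightarrow> bool" where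
  "is_drazin_inverse n A X \<longleftrightarrow>
     X \<in> carrier_mat n n \<and>
     A ^\<^sub>m Ind n A * X * A = A ^\<^sub>m Ind n A \<and>
     X * A * X = X \<and>
     A * X = X * A"

definition drazin_inverse :: "nat \<Rightarrow> complex mat \<Rightarrow> complex mat" where
  "drazin_inverse n A = (THE X. is_drazin_inverse n A X)"

end

theory Submission
  imports Defs
begin

text \<open>
  Let \<open>X\<close> be the m-core-EP inverse of \<open>A\<close> and \<open>E = X * A\<close>, an idempotent with the range of \<open>A\<^sup>k\<close>.
  Since \<open>A\<close> leaves that range invariant, \<open>X\<close> is a left inverse of \<open>A\<close> in the corner ring of \<open>E\<close>, hence
  by finite dimension also a right inverse. This yields \<open>A * X * A\<^sup>k = A\<^sup>k\<close> and \<open>A * X\<^sup>2 = X\<close>, from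
  which one checks that \<open>X\<^sup>k\<close> is the m-core inverse of \<open>A\<^sup>k\<close>, that \<open>X\<^bsup>k+1\<^esup> * A\<^sup>k\<close> is the Drazin inverse of
  \<open>A\<close>, and that their product with \<open>A\<^sup>k\<close> collapses to \<open>X\<close>.
\<close>

section \<open>Algebra of square matrices: powers and corner rings\<close>

text \<open>Lets a known product rewrite the head of a longer chain once
  \<open>assoc_mult_mat\<close> has nested all brackets to the right.\<close>

lemma assoc_mult_mat_eq:
  fixes A :: "'a :: semiring_0 mat"
  assumes "A \<in> carrier_mat n n" "B \<in> carrier_mat n n" "Z \<in> carrier_mat n n" "A * B = R"
  shows "A * (B * Z) = R * Z"
  using assoc_mult_mat[OF assms(1-3)] assms(4) by simp

lemma pow_mat_Suc_left:
  fixes A :: "'a :: semiring_1 mat"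
  assumes A: "A \<in> carrier_mat n n"
  shows "A ^\<^sub>m Suc m = A * A ^\<^sub>m m"
proof (induction m)
  case (Suc m)
  have "A ^\<^sub>m Suc (Suc m) = A * A ^\<^sub>m m * A"
    using Suc by simp
  also have "\<dots> = A * A ^\<^sub>m Suc m"
    using A assoc_mult_mat[OF A pow_carrier_mat[OF A] A] by simp
  finally show ?case .
qed (use A in simp)

lemma pow_mat_add:
  fixes A :: "'a :: semiring_1 mat"
  assumes A: "A \<in> carrier_mat n n"
  shows "A ^\<^sub>m (i + j) = A ^\<^sub>m i * A ^\<^sub>m j"
proof (induction j)
  case (Suc j)
  then show ?case
    using assoc_mult_mat[OF pow_carrier_mat[OF A] pow_carrier_mat[OF A] A] by simp
qed (use A in simp)

lemma pow_mat_two: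
  fixes A :: "'a :: semiring_1 mat"
  assumes "A \<in> carrier_mat n n"
  shows "A ^\<^sub>m 2 = A * A"
  using assms by (simp add: numeral_2_eq_2)

text \<open>Commutation turns the product into a power of the idempotent \<open>A * B\<close>. The
  exponent is a successor because the zeroth power would give the identity.\<close>

lemma mult_pow_mat_id:
  fixes A :: "'a :: semiring_1 mat"
  assumes A: "A \<in> carrier_mat n n" and B: "B \<in> carrier_mat n n" and AB: "A * B = B * A"
    and idem: "A * B * (A * B) = A * B"
  shows "A ^\<^sub>m Suc m * B ^\<^sub>m Suc m = A * B"
proof (induction m)
  case (Suc m)
  note [simp] = A B mult_carrier_mat[of _ n n _ n] assoc_mult_mat[of _ n n _ n _ n]
  have "A ^\<^sub>m Suc (Suc m) * B ^\<^sub>m Suc (Suc m) = A * (A ^\<^sub>m Suc m * B ^\<^sub>m Suc m) * B"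
    unfolding pow_mat_Suc_left[OF A, of "Suc m"] pow_mat.simps(2)[of B "Suc m"]
    by (simp del: pow_mat.simps)
  also have "\<dots> = A * (A * B) * B" by (simp only: Suc)
  also have "\<dots> = A * (B * A) * B" by (simp only: AB)
  also have "\<dots> = A * B" using idem by simp
  finally show ?case .
qed (use A B in simp)

text \<open>One-sided inverses are two-sided in the corner ring of the idempotent \<open>E\<close>:
  add \<open>1 - E\<close> to both factors.\<close>

lemma corner_mat_left_right_inverse:
  fixes A :: "'a :: field mat"
  assumes E: "E \<in> carrier_mat n n" and A: "A \<in> carrier_mat n n" and X: "X \<in> carrier_mat n n"
    and EE: "E * E = E" and EA: "E * A = A" and AE: "A * E = A" and EX: "E * X = X"
    and XE: "X * E = X" and XA: "X * A = E"
  shows "A * X = E"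
proof -
  let ?F = "1\<^sub>m n - E"
  note [simp] = E A X minus_carrier_mat[of _ n n] mult_carrier_mat[of _ n n _ n]
  have F: "?F \<in> carrier_mat n n" by simp
  have FF: "?F * ?F = ?F" and YF: "Y * ?F = 0\<^sub>m n n" and FZ: "?F * Z = 0\<^sub>m n n"
    if "Y \<in> carrier_mat n n" "Z \<in> carrier_mat n n" "Y * E = Y" "E * Z = Z" for Y Z
  proof -
    have "E * ?F = 0\<^sub>m n n"
      using EE by (simp add: mult_minus_distrib_mat[OF E one_carrier_mat E]
          right_mult_one_mat[OF E] minus_r_inv_mat[OF E])
    then show "?F * ?F = ?F"
      by (simp add: minus_mult_distrib_mat[OF one_carrier_mat E F] left_mult_one_mat[OF F])
        (auto intro!: eq_matI simp: carrier_matD[OF E])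
    show "Y * ?F = 0\<^sub>m n n"
      using mult_minus_distrib_mat[OF that(1) one_carrier_mat E] right_mult_one_mat[OF that(1)]
        minus_r_inv_mat[OF that(1)] that(3) by simp
    show "?F * Z = 0\<^sub>m n n"
      using minus_mult_distrib_mat[OF one_carrier_mat E that(2)] left_mult_one_mat[OF that(2)]
        minus_r_inv_mat[OF that(2)] that(4) by simp
  qed
  \<comment> \<open>The cross terms vanish, so adding \<open>?F\<close> carries products in the
    corner to products of full matrices, and \<open>E\<close> itself to the identity.\<close>
  have sum: "(Y + ?F) * (Z + ?F) = Y * Z + ?F"
    if Y: "Y \<in> carrier_mat n n" and Z: "Z \<in> carrier_mat n n" and YZ: "Y * E = Y" "E * Z = Z"
    for Y Z
    using add_mult_distrib_mat[OF Y F add_carrier_mat[OF F, of Z]]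
      mult_add_distrib_mat[OF Y Z F] mult_add_distrib_mat[OF F Z F]
      FF[OF that] YF[OF that] FZ[OF that] F Y Z by simp
  have "(X + ?F) * (A + ?F) = E + ?F" using sum[OF X A XE EA] XA by simp
  also have "\<dots> = 1\<^sub>m n" using carrier_matD[OF E] by (intro eq_matI) auto
  finally have "(A + ?F) * (X + ?F) = 1\<^sub>m n"
    by (intro mat_mult_left_right_inverse[of "X + ?F" n]) auto
  then have eq: "A * X + ?F = 1\<^sub>m n" using sum[OF A X AE EX] by simp
  have AX: "A * X \<in> carrier_mat n n" by simp
  show ?thesis
  proof (rule eq_matI)
    fix i j assume ij: "i < dim_row E" "j < dim_col E"
    have "(A * X + ?F) $$ (i, j) = 1\<^sub>m n $$ (i, j)" using eq by simp
    then show "(A * X) $$ (i, j) = E $$ (i, j)"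
      using ij carrier_matD[OF E] carrier_matD[OF AX] by (auto simp del: index_mult_mat(1) split: if_splits)
  qed (use carrier_matD[OF E] carrier_matD[OF A] carrier_matD[OF X] in auto)
qed

section \<open>The Minkowski metric and adjoint\<close>

lemma minkowski_metric_carrier: "n \<ge> 1 \<Longrightarrow> minkowski_metric n \<in> carrier_mat n n"
  unfolding minkowski_metric_def
  using four_block_carrier_mat[of "1\<^sub>m 1 :: complex mat" 1 1 "- 1\<^sub>m (n - 1)" "n - 1" "n - 1"]
  by simp

lemma minkowski_metric_square:
  assumes "n \<ge> 1"
  shows "minkowski_metric n * minkowski_metric n = 1\<^sub>m n"
proof -
  obtain m where n: "n = 1 + m" using assms le_Suc_ex by blast
  let ?I = "1\<^sub>m m :: complex mat" and ?Z = "0\<^sub>m 1 m :: complex mat"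
  have "- ?I * - ?I = ?I" "?Z * - ?I = 0\<^sub>m 1 m" "1\<^sub>m 1 * ?Z + ?Z * - ?I = ?Z"
    by (auto intro!: eq_matI)
  then show ?thesis unfolding minkowski_metric_def n
    by (subst mult_four_block_mat[of _ 1 1 _ m _ m _ _ 1 _ m]) auto
qed

lemma mat_adjoint_carrier: "A \<in> carrier_mat n m \<Longrightarrow> mat_adjoint A \<in> carrier_mat m n"
  by (intro carrier_matI) (simp_all add: mat_adjoint_def)

lemma mat_adjoint_index:
  assumes "A \<in> carrier_mat n m" "i < m" "j < n"
  shows "mat_adjoint A $$ (i, j) = conjugate (A $$ (j, i))"
  using assms by (auto simp: mat_adjoint_def mat_of_rows_index)

lemma mat_adjoint_mult:
  assumes A: "A \<in> carrier_mat n m" and B: "B \<in> carrier_mat m l"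
  shows "mat_adjoint (A * B) = mat_adjoint B * mat_adjoint A"
proof -
  note C = mat_adjoint_carrier[OF A] mat_adjoint_carrier[OF B] mult_carrier_mat[OF A B]
  show ?thesis
  proof (rule eq_matI)
    fix i j assume "i < dim_row (mat_adjoint B * mat_adjoint A)"
      "j < dim_col (mat_adjoint B * mat_adjoint A)"
    then have ij: "i < l" "j < n" using C by auto
    have "mat_adjoint (A * B) $$ (i, j) = conjugate (\<Sum>k<m. A $$ (j, k) * B $$ (k, i))"
      using ij carrier_matD[OF A] carrier_matD[OF B] mat_adjoint_index[OF C(3) ij]
      by (simp add: scalar_prod_def lessThan_atLeast0)
    also have "\<dots> = (\<Sum>k<m. conjugate (B $$ (k, i)) * conjugate (A $$ (j, k)))"
      by (simp add: sum_conjugate conjugate_dist_mul mult.commute)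
    also have "\<dots> = (mat_adjoint B * mat_adjoint A) $$ (i, j)"
      using ij carrier_matD[OF C(1)] carrier_matD[OF C(2)]
      by (simp add: scalar_prod_def lessThan_atLeast0 mat_adjoint_index[OF A]
          mat_adjoint_index[OF B])
    finally show "mat_adjoint (A * B) $$ (i, j) = (mat_adjoint B * mat_adjoint A) $$ (i, j)" .
  qed (use carrier_matD[OF C(1)] carrier_matD[OF C(2)]
      carrier_matD[OF mat_adjoint_carrier[OF C(3)]] in simp_all)
qed

text \<open>The two inner copies of the metric cancel because it squares to the identity.\<close>

lemma minkowski_adjoint_mult:
  assumes "n \<ge> 1" and A: "A \<in> carrier_mat n n" and B: "B \<in> carrier_mat n n"
  shows "minkowski_adjoint n (A * B) = minkowski_adjoint n B * minkowski_adjoint n A"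
proof -
  note G = minkowski_metric_carrier[OF assms(1)]
  note [simp] = G A B mat_adjoint_carrier[of _ n n] mult_carrier_mat[of _ n n _ n]
    assoc_mult_mat[of _ n n _ n _ n]
  show ?thesis
    by (simp add: minkowski_adjoint_def mat_adjoint_mult[OF A B]
        assoc_mult_mat_eq[OF G G _ minkowski_metric_square[OF assms(1)]]
        left_mult_one_mat[of _ n n])
qed

text \<open>\<open>P * Q = Q\<close> and \<open>Q * P = P\<close> say that the idempotents \<open>P\<close> and \<open>Q\<close> have the same range.\<close>

lemma minkowski_projector_unique:
  assumes "n \<ge> 1" "P \<in> carrier_mat n n" "Q \<in> carrier_mat n n"
    and "minkowski_adjoint n P = P" "minkowski_adjoint n Q = Q" "P * Q = Q" "Q * P = P"
  shows "P = Q"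
  \<comment> \<open>The adjoint of \<open>P * Q = Q\<close> reads \<open>Q * P = Q\<close>, whereas
    \<open>Q * P = P\<close>.\<close>
  using minkowski_adjoint_mult[of n P Q] assms by metis

section \<open>Column spaces, factorizations and rank\<close>

lemma col_space_mult_subset:
  fixes A :: "complex mat"
  assumes A: "A \<in> carrier_mat n m" and B: "B \<in> carrier_mat m l"
  shows "col_sp n (A * B) \<subseteq> col_sp n A"
  unfolding vec_space.col_space_eq[OF A] vec_space.col_space_eq[OF mult_carrier_mat[OF A B]]
  using A B by (auto simp: assoc_mult_mat_vec[OF A B])

text \<open>Each column of \<open>B\<close> is \<open>A\<close> applied to some vector; these
  vectors are the columns of \<open>Y\<close>. This makes the range condition on the m-core-EP
  inverse algebraic.\<close>

lemma col_space_subset_factor: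
  fixes A :: "complex mat"
  assumes A: "A \<in> carrier_mat n m" and B: "B \<in> carrier_mat n l"
    and sub: "col_sp n B \<subseteq> col_sp n A"
  obtains Y where "Y \<in> carrier_mat m l" "B = A * Y"
proof -
  have "\<exists>y \<in> carrier_vec m. A *\<^sub>v y = col B j" if "j < l" for j
  proof -
    have "col B j = B *\<^sub>v unit_vec l j"
      using B that by (intro eq_vecI) auto
    then have "col B j \<in> col_sp n B"
      unfolding vec_space.col_space_eq[OF B] using B that by auto
    then show ?thesis using sub A unfolding vec_space.col_space_eq[OF A] by auto
  qed
  then obtain y where y: "\<And>j. j < l \<Longrightarrow> y j \<in> carrier_vec m \<and> A *\<^sub>v y j = col B j"
    by metis
  let ?Y = "mat_of_cols m (map y [0..<l])"
  have Y: "?Y \<in> carrier_mat m l" by (simp add: mat_of_cols_def)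
  have "B = A * ?Y"
  proof (rule mat_col_eqI)
    fix j assume "j < dim_col (A * ?Y)"
    then have j: "j < l" using Y by simp
    then show "col B j = col (A * ?Y) j"
      using y[OF j] Y by (simp add: col_mult2[OF A Y j])
  qed (use A B Y in auto)
  with Y show ?thesis by (rule that)
qed

text \<open>Mutual factorization makes the column spaces equal, and the rank depends on nothing
  else.\<close>

lemma rk_eq_if_factors:
  assumes A: "A \<in> carrier_mat n n" and "Y \<in> carrier_mat n n" "Z \<in> carrier_mat n n"
    and B: "B = A * Y" and "A = B * Z"
  shows "rk n A = rk n B"
proof -
  have Bc: "B \<in> carrier_mat n n" unfolding B using assms(1,2) by (rule mult_carrier_mat)
  have "col_sp n B \<subseteq> col_sp n A"
    unfolding B by (rule col_space_mult_subset[OF assms(1,2)])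
  moreover have "col_sp n A \<subseteq> col_sp n B"
    by (subst assms(5)) (rule col_space_mult_subset[OF Bc assms(3)])
  ultimately have "col_sp n A = col_sp n B" by blast
  then show ?thesis
    unfolding vec_space.rank_def vec_space.col_space_def by simp
qed

section \<open>Uniqueness of the Drazin and m-core inverses\<close>

lemma pow_mat_commute:
  fixes A :: "'a :: semiring_1 mat"
  assumes A: "A \<in> carrier_mat n n" and B: "B \<in> carrier_mat n n" and AB: "A * B = B * A"
  shows "A ^\<^sub>m m * B = B * A ^\<^sub>m m"
proof (induction m)
  case (Suc m)
  note [simp] = A B mult_carrier_mat[of _ n n _ n] assoc_mult_mat[of _ n n _ n _ n]
  have "A ^\<^sub>m Suc m * B = A ^\<^sub>m m * B * A" using AB by simp
  also have "\<dots> = B * A ^\<^sub>m Suc m" using Suc by simp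
  finally show ?case .
qed (use A B in auto)

text \<open>Both inverses equal \<open>Y * A * X\<close>: write \<open>X\<close> as the
  \<open>k\<close>-th power of \<open>A\<close> times a power of \<open>X\<close>, write
  \<open>Y\<close> with the factors in the opposite order, and let the other inverse raise the
  exponent of \<open>A\<close> to \<open>k + 1\<close>.\<close>

lemma is_drazin_inverse_unique:
  assumes A: "A \<in> carrier_mat n n"
    and X: "is_drazin_inverse n A X" and Y: "is_drazin_inverse n A Y"
  shows "X = Y"
proof -
  define k where "k = Ind n A"
  note [simp del] = pow_mat.simps
  note [simp] = A mult_carrier_mat[of _ n n _ n] assoc_mult_mat[of _ n n _ n _ n]
  have *: "Z * A ^\<^sub>m Suc k = A ^\<^sub>m k \<and> A ^\<^sub>m Suc k * Z = A ^\<^sub>m k \<and>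
      A ^\<^sub>m Suc k * Z ^\<^sub>m Suc k = A * Z \<and> Z ^\<^sub>m Suc k * A ^\<^sub>m Suc k = Z * A \<and>
      A ^\<^sub>m k * Z ^\<^sub>m Suc k = Z \<and> Z ^\<^sub>m Suc k * A ^\<^sub>m k = Z"
    if Z: "is_drazin_inverse n A Z" for Z
  proof -
    have Zc [simp]: "Z \<in> carrier_mat n n" and e: "A ^\<^sub>m k * Z * A = A ^\<^sub>m k"
      and z: "Z * A * Z = Z" and c: "A * Z = Z * A"
      using Z unfolding is_drazin_inverse_def k_def by auto
    have r: "A ^\<^sub>m Suc k * Z = A ^\<^sub>m k" using e c by (simp add: pow_mat.simps)
    have l: "Z * A ^\<^sub>m Suc k = A ^\<^sub>m k"
      using r pow_mat_commute[OF A Zc c, of "Suc k"] by simp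
    have pl: "A ^\<^sub>m Suc k * Z ^\<^sub>m Suc k = A * Z"
      using z by (intro mult_pow_mat_id[OF A Zc c]) simp
    have pr: "Z ^\<^sub>m Suc k * A ^\<^sub>m Suc k = Z * A"
    proof (intro mult_pow_mat_id[OF Zc A c[symmetric]])
      have "Z * A * (Z * A) = Z * A * Z * A" by simp
      then show "Z * A * (Z * A) = Z * A" unfolding z .
    qed
    have "A ^\<^sub>m k * Z ^\<^sub>m Suc k = Z * (A ^\<^sub>m Suc k * Z ^\<^sub>m Suc k)" using l
      by (simp flip: assoc_mult_mat[of _ n n _ n _ n])
    moreover have "Z ^\<^sub>m Suc k * A ^\<^sub>m k = Z ^\<^sub>m Suc k * A ^\<^sub>m Suc k * Z" using r by simp
    ultimately show ?thesis using l r pl pr z by simp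
  qed
  have [simp]: "X \<in> carrier_mat n n" "Y \<in> carrier_mat n n"
    using X Y unfolding is_drazin_inverse_def by auto
  have "X = Y * A ^\<^sub>m Suc k * X ^\<^sub>m Suc k" using *[OF X] *[OF Y] by metis
  also have "\<dots> = Y * A * X" using *[OF X] by simp
  finally have "X = Y * A * X" .
  moreover have "Y = Y ^\<^sub>m Suc k * (A ^\<^sub>m Suc k * X)" using *[OF X] *[OF Y] by metis
  then have "Y = Y ^\<^sub>m Suc k * A ^\<^sub>m Suc k * X" by simp
  then have "Y = Y * A * X" using *[OF Y] by metis
  ultimately show ?thesis by simp
qed

text \<open>The left inverse \<open>W\<close> of \<open>B\<close> on its range stands in for the rank condition.\<close>

lemma is_m_core_inverse_unique:
  assumes "n \<ge> 1" and Bc: "B \<in> carrier_mat n n"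
    and Z: "is_m_core_inverse n B Z" and W: "is_m_core_inverse n B W"
    and WBB: "W * (B * B) = B"
  shows "Z = W"
proof -
  have [simp]: "B \<in> carrier_mat n n" "Z \<in> carrier_mat n n" "W \<in> carrier_mat n n"
    using assms unfolding is_m_core_inverse_def by auto
  note [simp] = mult_carrier_mat[of _ n n _ n] assoc_mult_mat[of _ n n _ n _ n]
  have z: "B * (Z * B) = B" "B * (Z * Z) = Z" "minkowski_adjoint n (B * Z) = B * Z"
    and w: "B * (W * B) = B" "B * (W * W) = W" "minkowski_adjoint n (B * W) = B * W"
    using Z W unfolding is_m_core_inverse_def by (auto simp: pow_mat_two[of _ n])
  have "(B * Z) * (B * W) = B * (Z * B) * W" "(B * W) * (B * Z) = B * (W * B) * Z" by simp_all
  then have P: "B * Z = B * W"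
    using minkowski_projector_unique[OF assms(1), of "B * Z" "B * W"] z w by simp
  \<comment> \<open>A solution \<open>Q\<close> lies in the range of \<open>B\<close>, where
    \<open>W\<close> undoes \<open>B\<close>; hence \<open>Q\<close> is determined by
    \<open>B * Q\<close>.\<close>
  have left: "Q = W * (B * Q)" if Q: "Q \<in> carrier_mat n n" "B * (Q * Q) = Q" for Q
  proof -
    have "W * (B * B) * (Q * Q) = W * (B * (B * (Q * Q)))" using Q by simp
    then show ?thesis using WBB Q by simp
  qed
  show ?thesis using left[OF _ z(2)] left[OF _ w(2)] P by simp
qed

section \<open>Structure and uniqueness of the m-core-EP inverse\<close>

lemma m_core_EP_inverse_props:
  fixes A :: "complex mat" and n :: nat
  defines "k \<equiv> Ind n A"
  assumes A: "A \<in> carrier_mat n n" and X: "is_m_core_EP_inverse n A X"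
  obtains Y where "Y \<in> carrier_mat n n" "X = A ^\<^sub>m k * Y"
    "A * X * A ^\<^sub>m k = A ^\<^sub>m k" "A * X * X = X"
proof -
  note [simp del] = pow_mat.simps
  note [simp] = mult_carrier_mat[of _ n n _ n] assoc_mult_mat[of _ n n _ n _ n]
  have Xc [simp]: "X \<in> carrier_mat n n" and XAX: "X * A * X = X"
    and XAk: "X * A ^\<^sub>m Suc k = A ^\<^sub>m k" and sub: "col_sp n X \<subseteq> col_sp n (A ^\<^sub>m k)"
    using X unfolding is_m_core_EP_inverse_def k_def by auto
  note Ac [simp] = A
  obtain Y where Yc [simp]: "Y \<in> carrier_mat n n" and Y: "X = A ^\<^sub>m k * Y"
    using col_space_subset_factor[OF pow_carrier_mat[OF A] Xc sub] .
  define E where "E = X * A"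
  have Ec [simp]: "E \<in> carrier_mat n n" by (simp add: E_def)
  have EE: "E * E = E" and EX: "E * X = X" using XAX
    by (simp_all add: E_def flip: assoc_mult_mat[of _ n n _ n _ n])
  have EAk: "E * A ^\<^sub>m k = A ^\<^sub>m k"
    using XAk pow_mat_Suc_left[OF A, of k] by (simp add: E_def)
  \<comment> \<open>Invariance of the range of \<open>E\<close> under \<open>A\<close>:
    \<open>E\<close> factors through the \<open>k\<close>-th power of \<open>A\<close>, which
    commutes with \<open>A\<close> and is fixed by \<open>E\<close>.\<close>
  have "A * E = A * A ^\<^sub>m k * (Y * A)" by (simp add: E_def Y)
  also have "\<dots> = A ^\<^sub>m k * (A * (Y * A))"
    by (simp flip: pow_mat_commute[OF A A refl, of k])
  finally have AE: "A * E = A ^\<^sub>m k * (A * (Y * A))" .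
  have "E * (A * E) = E * A ^\<^sub>m k * (A * (Y * A))" unfolding AE by simp
  also have "\<dots> = A ^\<^sub>m k * (A * (Y * A))" unfolding EAk ..
  also have "\<dots> = A * E" using AE ..
  finally have EAE: "E * (A * E) = A * E" .
  have "(X * E) * (A * E) = X * (E * (A * E))" by simp
  also have "\<dots> = E" using EE EAE by (simp add: E_def)
  finally have XAE: "(X * E) * (A * E) = E" .
  \<comment> \<open>The compressions \<open>A * E\<close> and \<open>X * E\<close> lie in the corner
    of \<open>E\<close>, so the corner lemma is applied to them rather than to \<open>A\<close> and
    \<open>X\<close>.\<close>
  have "(A * E) * (X * E) = E"
    by (rule corner_mat_left_right_inverse[of E n])
      (use EE EAE XAE in \<open>simp_all add: assoc_mult_mat_eq[OF Ec Xc _ EX]\<close>)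
  then have AXE: "A * (X * E) = E" by (simp add: assoc_mult_mat_eq[OF Ec Xc _ EX])
  have "A * X * A ^\<^sub>m k = A * (X * E) * A ^\<^sub>m k" using EAk by simp
  then have 1: "A * X * A ^\<^sub>m k = A ^\<^sub>m k" unfolding AXE EAk .
  have "A * X * X = A * (X * E) * X" using EX by simp
  then have 2: "A * X * X = X" unfolding AXE EX .
  show ?thesis by (rule that[OF Yc Y 1 2])
qed

text \<open>\<open>A * X\<close> and \<open>A * Z\<close> are selfadjoint projectors with the same
  range, hence equal; then \<open>X = X * (A * X) = X * A * Z = Z\<close>.\<close>

lemma is_m_core_EP_inverse_unique:
  assumes "n \<ge> 1" and A: "A \<in> carrier_mat n n"
    and X: "is_m_core_EP_inverse n A X" and Z: "is_m_core_EP_inverse n A Z"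
  shows "X = Z"
proof -
  define k where "k = Ind n A"
  note [simp del] = pow_mat.simps
  note [simp] = A mult_carrier_mat[of _ n n _ n] assoc_mult_mat[of _ n n _ n _ n]
  \<comment> \<open>\<open>Q\<close> and \<open>A * Q\<close> both factor through the
    \<open>k\<close>-th power of \<open>A\<close>, which \<open>P * A\<close> and
    \<open>A * P\<close> fix.\<close>
  have *: "A * P * (A * Q) = A * Q \<and> P * A * Q = Q"
    if P: "is_m_core_EP_inverse n A P" and Q: "is_m_core_EP_inverse n A Q" for P Q
  proof -
    have [simp]: "P \<in> carrier_mat n n" and PA: "P * A ^\<^sub>m Suc k = A ^\<^sub>m k"
      using P unfolding is_m_core_EP_inverse_def k_def by auto
    obtain Y where [simp]: "Y \<in> carrier_mat n n" and Y: "Q = A ^\<^sub>m k * Y"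
      using m_core_EP_inverse_props[OF A Q] unfolding k_def .
    have "P * A * Q = P * A ^\<^sub>m Suc k * Y"
      by (simp add: Y pow_mat_Suc_left[OF A])
    then have "P * A * Q = Q" unfolding PA Y .
    moreover have "A * P * (A * Q) = A * Q"
    proof -
      have APAk: "A * P * A ^\<^sub>m k = A ^\<^sub>m k"
        using m_core_EP_inverse_props[OF A P] unfolding k_def by metis
      have "A * Q = A * A ^\<^sub>m k * Y" by (simp add: Y)
      then have AQ: "A * Q = A ^\<^sub>m k * (A * Y)"
        by (simp flip: pow_mat_commute[OF A A refl, of k])
      have "A * P * (A * Q) = A * P * A ^\<^sub>m k * (A * Y)" unfolding AQ by simp
      then show ?thesis unfolding APAk AQ .
    qed
    ultimately show ?thesis by simp
  qed
  have [simp]: "X \<in> carrier_mat n n" "Z \<in> carrier_mat n n"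
    and "minkowski_adjoint n (A * X) = A * X" "minkowski_adjoint n (A * Z) = A * Z"
    using X Z unfolding is_m_core_EP_inverse_def by auto
  then have eq: "A * X = A * Z"
    using minkowski_projector_unique[OF assms(1), of "A * X" "A * Z"] *[OF X Z] *[OF Z X]
    by simp
  have "X = X * (A * X)" using *[OF X X] by simp
  also have "\<dots> = Z" using *[OF X Z] eq by simp
  finally show ?thesis .
qed

section \<open>The m-core-EP inverse in terms of the Drazin and m-core inverses\<close>

theorem theorem2p6:
  fixes A :: "complex mat" and n k :: nat
  assumes "n \<ge> 1"
    and "A \<in> carrier_mat n n"
    and "Ind n A = k"
    and "m_core_EP_invertible n A"
  shows "m_core_invertible n (A ^\<^sub>m k) \<and>
    m_core_EP_inverse n A = A ^\<^sub>m k * drazin_inverse n A * m_core_inverse n (A ^\<^sub>m k)"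
proof -
  note A [simp] = assms(2)
  obtain X where X: "is_m_core_EP_inverse n A X"
    using assms(4) unfolding m_core_EP_invertible_def by blast
  note [simp del] = pow_mat.simps
  note [simp] = mult_carrier_mat[of _ n n _ n] assoc_mult_mat[of _ n n _ n _ n]
  have Xc [simp]: "X \<in> carrier_mat n n" and XAX: "X * A * X = X"
    and XAk: "X * A ^\<^sub>m Suc k = A ^\<^sub>m k" and adj: "minkowski_adjoint n (A * X) = A * X"
    using X assms(3) unfolding is_m_core_EP_inverse_def by auto
  obtain Y where Yc [simp]: "Y \<in> carrier_mat n n" and Y: "X = A ^\<^sub>m k * Y"
    and AXAk: "A * X * A ^\<^sub>m k = A ^\<^sub>m k" and AXX: "A * X * X = X"
    using m_core_EP_inverse_props[OF A X] assms(3) by auto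
  define B W where "B = A ^\<^sub>m k" and "W = X ^\<^sub>m k"
  have [simp]: "B \<in> carrier_mat n n" "W \<in> carrier_mat n n" by (simp_all add: B_def W_def)
  have AXB: "A * X * B = B" using AXAk by (simp add: B_def)
  have BAB: "A * B = B * A" using pow_mat_commute[OF A A refl, of k] by (simp add: B_def)
  have XAB: "X * A * B = B" using XAk pow_mat_Suc_left[OF A, of k] by (simp add: B_def)
  have AXpow: "A * X * X ^\<^sub>m j = X ^\<^sub>m j" if j: "j > 0" for j
  proof -
    obtain i where "j = Suc i" using gr0_implies_Suc[OF j] by blast
    then show ?thesis using AXX
      by (simp add: pow_mat_Suc_left[OF Xc] flip: assoc_mult_mat[of _ n n _ n _ n])
  qed
  note dims = carrier_matD[OF A] carrier_matD[OF Xc] left_mult_one_mat[of _ n n]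
    right_mult_one_mat[of _ n n]
  \<comment> \<open>Positivity of \<open>k\<close> is not derived from the \<open>LEAST\<close> in
    \<open>Ind\<close>; the case \<open>k = 0\<close> is settled directly.\<close>
  have AX1: "A * X = 1\<^sub>m n" if "k = 0"
    using AXAk that by (simp add: pow_mat.simps dims)
  have AXW: "A * X * W = W"
  proof (cases "k = 0")
    case True
    then show ?thesis unfolding AX1[OF True] by (simp add: dims)
  next
    case False
    then show ?thesis using AXpow[of k] by (simp add: W_def)
  qed
  \<comment> \<open>Telescoping: the inner \<open>A * X\<close> is absorbed by the remaining power
    of \<open>X\<close>, which is positive thanks to the extra factor.\<close>
  have pow: "A ^\<^sub>m j * X ^\<^sub>m Suc j = X" for j
  proof (induction j)
    case (Suc j)
    have "A ^\<^sub>m Suc j * X ^\<^sub>m Suc (Suc j) = A ^\<^sub>m j * (A * X * X ^\<^sub>m Suc j)"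
      by (simp add: pow_mat.simps(2)[of A] pow_mat_Suc_left[OF Xc, of "Suc j"])
    also have "\<dots> = X" using AXpow[of "Suc j"] Suc by simp
    finally show ?case .
  qed (simp add: pow_mat.simps dims)
  \<comment> \<open>The inner \<open>X * A\<close> cancels since powers of \<open>A\<close> commute
    with \<open>B\<close> and so keep the range of \<open>B\<close>.\<close>
  have XpB: "X ^\<^sub>m j * A ^\<^sub>m j * B = B" for j
  proof (induction j)
    case (Suc j)
    have comm: "A ^\<^sub>m j * B = B * A ^\<^sub>m j"
      using pow_mat_add[OF A, of j k] pow_mat_add[OF A, of k j]
      by (simp add: B_def add.commute)
    have "X ^\<^sub>m Suc j * A ^\<^sub>m Suc j * B = X ^\<^sub>m j * (X * A * (A ^\<^sub>m j * B))"
      by (simp add: pow_mat.simps(2)[of X] pow_mat_Suc_left[OF A])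
    also have "X * A * (A ^\<^sub>m j * B) = X * A * B * A ^\<^sub>m j" unfolding comm by simp
    also have "\<dots> = A ^\<^sub>m j * B" unfolding XAB comm ..
    finally show ?case using Suc by simp
  qed (simp add: pow_mat.simps dims)
  have WBB: "W * (B * B) = B" using XpB[of k] by (simp add: W_def B_def)
  \<comment> \<open>This equality transfers the selfadjointness of \<open>A * X\<close> to
    \<open>B * W\<close>.\<close>
  have BW: "B * W = A * X"
  proof (cases k)
    case 0
    then show ?thesis using AX1 by (simp add: B_def W_def pow_mat.simps dims)
  next
    case (Suc j)
    then show ?thesis using pow[of j] by (simp add: B_def W_def pow_mat_Suc_left[OF A])
  qed
  have WX: "W * X = X * W" using pow_mat_commute[OF Xc Xc refl, of k] by (simp add: W_def)
  have BWB: "B * (W * B) = B" and BWW: "B * (W * W) = W" and AXW': "A * (X * W) = W"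
    using AXB AXW by (simp_all flip: BW assoc_mult_mat[of _ n n _ n _ n])

  \<comment> \<open>For the rank condition, \<open>B\<close> must factor through
    \<open>B * B\<close>; the witness is \<open>W * W * B\<close>.\<close>
  have "B * (W * W * B) = W * B" using BWW by (simp flip: assoc_mult_mat[of _ n n _ n _ n])
  then have "B = B * B * (W * W * B)" using BWB by simp
  then have "rk n (B * B) = rk n B"
    using rk_eq_if_factors[of B n B "W * W * B" "B * B"] by simp
  then have core: "is_m_core_inverse n B W"
    using BWB BWW AXB adj BW unfolding is_m_core_inverse_def by (simp add: pow_mat_two[of _ n])

  \<comment> \<open>\<open>A * D\<close> and \<open>D * A\<close> will both collapse to the
    idempotent \<open>W * B\<close>, from which the Drazin equations follow.\<close>
  define D where "D = X * (W * B)"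
  have [simp]: "D \<in> carrier_mat n n" by (simp add: D_def)
  have AD: "A * D = W * B"
    using AXW' by (simp add: D_def flip: assoc_mult_mat[of _ n n _ n _ n])
  have "D * A = W * X * A * B" by (simp add: D_def WX BAB)
  also have "\<dots> = W * B" using XAB by simp
  finally have DA: "D * A = W * B" .
  have "D * (A * D) = D" unfolding AD using BWB by (simp add: D_def)
  then have "W * B * D = D" unfolding DA[symmetric] by simp
  then have drazin: "is_drazin_inverse n A D"
    using AD DA BWB assms(3) unfolding is_drazin_inverse_def by (simp flip: B_def)

  \<comment> \<open>Moving \<open>W\<close> past \<open>X\<close> exposes two copies of
    \<open>B * W\<close>, which is \<open>A * X\<close>.\<close>
  have "B * D * W = B * (X * W) * (B * W)" by (simp add: D_def)
  also have "\<dots> = B * W * X * (B * W)" by (simp flip: WX)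
  also have "\<dots> = A * X * X * (A * X)" by (simp only: BW)
  also have "\<dots> = X" using AXX XAX by simp
  finally have "X = B * D * W" ..
  moreover have "m_core_EP_inverse n A = X"
    unfolding m_core_EP_inverse_def
    by (rule the_equality, rule X, rule is_m_core_EP_inverse_unique[OF assms(1) A _ X])
  moreover have "drazin_inverse n A = D"
    unfolding drazin_inverse_def
    by (rule the_equality, rule drazin, rule is_drazin_inverse_unique[OF A _ drazin])
  moreover have "m_core_inverse n B = W"
    unfolding m_core_inverse_def
    by (rule the_equality, rule core,
        rule is_m_core_inverse_unique[OF assms(1) \<open>B \<in> carrier_mat n n\<close> _ core WBB])
  moreover have "m_core_invertible n B"
    unfolding m_core_invertible_def using core by blast
  ultimately show ?thesis by (simp flip: B_def)
qed

end
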